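(* Let $N$ be a loop with the left inverse property, $H$ a group, $\phi:H\to Sym(N)_1$ a group homomorphism, and $L=N\rtimes_\phi H$. Then the commutant of $L$ is $$C(L)=\{(x,y)\in N\times H\mid x\in Fix(\phi),\ y\in Z(H)\ \text{and}\ \phi_y=i_{x^{-1}}\}.$$
   Context: A loop is a non-empty set with a binary operation such that for all $a,b$ the equations $xa=b$ and $ax=b$ have unique solutions, and there is a two-sided identity $1$. A loop $N$ has the left inverse property if every $x\in N$ has an inverse $x^{-1}$ with $x^{-1}(xy)=y$ for all $y\in N$ (inverses are then two-sided). $Sym(N)_1$ is the stabilizer of $1$ in the group of permutations of $N$; write $\phi_h=\phi(h)$. $N\rtimes_\phi H$ is the loop on $N\times H$ with operation $(n_1,h_1)(n_2,h_2)=(n_1\phi_{h_1}(n_2),h_1h_2)$. The commutant of $L$ is $C(L)=\{a\in L\mid ax=xa\ \forall x\in L\}$. $Fix(\phi)=\{n\in N\mid\phi_h(n)=n\ \text{for all } h\in H\}$. $Z(H)$ is the center of $H$. For $n\in N$, $i_n:N\to N$ is the map $i_n(n')=n(n'n^{-1})$; thus $i_{x^{-1}}(a)=x^{-1}(ax)$. *)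

theory Defs
  imports "HOL-Algebra.Group_Action"
begin

text \<open>
  Loops are encoded as the monoid records of HOL-Algebra (carrier, multiplication, identity),
  without associativity.
\<close>

locale loop =
  fixes N (structure)
  assumes m_closed: "\<lbrakk>x \<in> carrier N; y \<in> carrier N\<rbrakk> \<Longrightarrow> x \<otimes> y \<in> carrier N"
    and one_closed: "\<one> \<in> carrier N"
    and l_one: "x \<in> carrier N \<Longrightarrow> \<one> \<otimes> x = x"
    and r_one: "x \<in> carrier N \<Longrightarrow> x \<otimes> \<one> = x"
    and ex1_left: "\<lbrakk>a \<in> carrier N; b \<in> carrier N\<rbrakk> \<Longrightarrow> \<exists>!x. x \<in> carrier N \<and> x \<otimes> a = b"
    and ex1_right: "\<lbrakk>a \<in> carrier N; b \<in> carrier N\<rbrakk> \<Longrightarrow> \<exists>!x. x \<in> carrier N \<and> a \<otimes> x = b"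

locale lip_loop = loop +
  assumes left_inverse_property:
    "x \<in> carrier N \<Longrightarrow> \<exists>x' \<in> carrier N. \<forall>y \<in> carrier N. x' \<otimes> (x \<otimes> y) = y"

text \<open>
  The library's \<open>inv\<close> is the unique two-sided inverse in the carrier, defined for arbitrary
  monoid records. In a loop with the left inverse property it is the element given by that
  property, which is the only one:
\<close>

lemma (in lip_loop) left_inverse_two_sided:
  assumes x: "x \<in> carrier N" and x': "x' \<in> carrier N"
    and lip: "\<forall>y \<in> carrier N. x' \<otimes> (x \<otimes> y) = y"
  shows "x' \<otimes> x = \<one>" and "x \<otimes> x' = \<one>"
proof -
  show 1: "x' \<otimes> x = \<one>"
    using lip one_closed r_one x by force
  have "x' \<otimes> (x \<otimes> x') = x' \<otimes> \<one>"
    using lip x' r_one by simp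
  then show "x \<otimes> x' = \<one>"
    using ex1_right[OF x' x'] m_closed[OF x x'] one_closed r_one[OF x'] by metis
qed

lemma (in lip_loop) inv_eq:
  assumes x: "x \<in> carrier N" and x': "x' \<in> carrier N"
    and lip: "\<forall>y \<in> carrier N. x' \<otimes> (x \<otimes> y) = y"
  shows "inv x = x'"
  unfolding m_inv_def
proof (rule the_equality)
  show "x' \<in> carrier N \<and> x \<otimes> x' = \<one> \<and> x' \<otimes> x = \<one>"
    using left_inverse_two_sided[OF assms] x' by simp
next
  fix z assume "z \<in> carrier N \<and> x \<otimes> z = \<one> \<and> z \<otimes> x = \<one>"
  then show "z = x'"
    using ex1_left[OF x one_closed] left_inverse_two_sided[OF assms] x' by blast
qed

lemma (in lip_loop)
  assumes x: "x \<in> carrier N"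
  shows inv_closed: "inv x \<in> carrier N"
    and inv_left: "y \<in> carrier N \<Longrightarrow> inv x \<otimes> (x \<otimes> y) = y"
    and inv_inv: "inv (inv x) = x"
proof -
  obtain x' where x': "x' \<in> carrier N" and lip: "\<forall>y \<in> carrier N. x' \<otimes> (x \<otimes> y) = y"
    using left_inverse_property[OF x] by blast
  note eq = inv_eq[OF x x' lip]
  show "inv x \<in> carrier N" and "y \<in> carrier N \<Longrightarrow> inv x \<otimes> (x \<otimes> y) = y"
    using eq x' lip by auto
  obtain x'' where x'': "x'' \<in> carrier N"
    and lip'': "\<forall>y \<in> carrier N. x'' \<otimes> (x' \<otimes> y) = y"
    using left_inverse_property[OF x'] by blast
  have "x'' = x"
    using left_inverse_two_sided[OF x' x'' lip''] left_inverse_two_sided[OF x x' lip]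
      ex1_right[OF x' one_closed] x x'' by blast
  then show "inv (inv x) = x"
    using inv_eq[OF x' x'' lip''] eq by simp
qed

definition Sym1 :: "('a, 'c) monoid_scheme \<Rightarrow> ('a \<Rightarrow> 'a) monoid"
  where "Sym1 N = (BijGroup (carrier N))
    \<lparr>carrier := stabilizer (BijGroup (carrier N)) (\<lambda>f. f) \<one>\<^bsub>N\<^esub>\<rparr>"

definition semidirect ::
  "('a, 'c) monoid_scheme \<Rightarrow> ('h \<Rightarrow> 'a \<Rightarrow> 'a) \<Rightarrow> ('h, 'd) monoid_scheme \<Rightarrow> ('a \<times> 'h) monoid"
  where "semidirect N \<phi> H =
    \<lparr>carrier = carrier N \<times> carrier H,
     mult = \<lambda>(n1, h1) (n2, h2). (n1 \<otimes>\<^bsub>N\<^esub> \<phi> h1 n2, h1 \<otimes>\<^bsub>H\<^esub> h2),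
     one = (\<one>\<^bsub>N\<^esub>, \<one>\<^bsub>H\<^esub>)\<rparr>"

definition commutant :: "('a, 'c) monoid_scheme \<Rightarrow> 'a set"
  where "commutant L = {a \<in> carrier L. \<forall>x \<in> carrier L. a \<otimes>\<^bsub>L\<^esub> x = x \<otimes>\<^bsub>L\<^esub> a}"

definition group_center :: "('h, 'd) monoid_scheme \<Rightarrow> 'h set"
  where "group_center H = {z \<in> carrier H. \<forall>h \<in> carrier H. z \<otimes>\<^bsub>H\<^esub> h = h \<otimes>\<^bsub>H\<^esub> z}"

definition Fix ::
  "('a, 'c) monoid_scheme \<Rightarrow> ('h, 'd) monoid_scheme \<Rightarrow> ('h \<Rightarrow> 'a \<Rightarrow> 'a) \<Rightarrow> 'a set"
  where "Fix N H \<phi> = {n \<in> carrier N. \<forall>h \<in> carrier H. \<phi> h n = n}"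

text \<open>
  The map \<open>i\<^sub>n\<close> is made extensional, like the elements of \<^const>\<open>BijGroup\<close>, so that equality
  with a permutation of the carrier means equality as maps on the carrier.
\<close>

definition imap :: "('a, 'c) monoid_scheme \<Rightarrow> 'a \<Rightarrow> 'a \<Rightarrow> 'a"
  where "imap N n = (\<lambda>n' \<in> carrier N. n \<otimes>\<^bsub>N\<^esub> (n' \<otimes>\<^bsub>N\<^esub> inv\<^bsub>N\<^esub> n))"

lemma (in lip_loop) imap_inv:
  assumes "x \<in> carrier N" and "a \<in> carrier N"
  shows "imap N (inv x) a = inv x \<otimes> (a \<otimes> x)"
  using assms by (simp add: imap_def inv_inv)

lemma hom_Sym1_D:
  assumes "\<phi> \<in> hom H (Sym1 N)" and "h \<in> carrier H"
  shows "\<phi> h \<in> extensional (carrier N)" and "bij_betw (\<phi> h) (carrier N) (carrier N)"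
    and "\<phi> h \<one>\<^bsub>N\<^esub> = \<one>\<^bsub>N\<^esub>"
  using assms by (auto simp: Sym1_def hom_def stabilizer_def BijGroup_def Bij_def)

lemma loop_semidirect:
  assumes "loop N" and "group H" and \<phi>: "\<phi> \<in> hom H (Sym1 N)"
  shows "loop (semidirect N \<phi> H)"
proof -
  interpret N: loop N by fact
  interpret H: group H by fact
  note bij = hom_Sym1_D(2)[OF \<phi>]
  have cl: "\<phi> h n \<in> carrier N" if "h \<in> carrier H" "n \<in> carrier N" for h n
    using bij[OF that(1)] that(2) by (auto simp: bij_betw_def)
  have "group_hom H (BijGroup (carrier N)) \<phi>"
    using \<phi> H.group_axioms group_BijGroup
    by (auto simp: group_hom_def group_hom_axioms_def hom_def Sym1_def stabilizer_def)
  then have \<phi>1: "\<phi> \<one>\<^bsub>H\<^esub> = (\<lambda>n \<in> carrier N. n)"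
    using group_hom.hom_one by (fastforce simp: BijGroup_def)
  show ?thesis
  proof (unfold_locales, goal_cases)
    case (1 x y) then show ?case by (auto simp: semidirect_def N.m_closed cl)
  next
    case 2 then show ?case by (auto simp: semidirect_def N.one_closed)
  next
    case (3 x) then show ?case by (auto simp: semidirect_def N.l_one \<phi>1)
  next
    case (4 x) then show ?case by (auto simp: semidirect_def N.r_one hom_Sym1_D(3)[OF \<phi>])
  next
    case (5 a b)
    obtain n k m l where ab: "a = (n, k)" "b = (m, l)" by (cases a, cases b)
    with 5 have c: "n \<in> carrier N" "k \<in> carrier H" "m \<in> carrier N" "l \<in> carrier H"
      by (auto simp: semidirect_def)
    define h where "h = l \<otimes>\<^bsub>H\<^esub> inv\<^bsub>H\<^esub> k"
    have h: "h \<in> carrier H" "h \<otimes>\<^bsub>H\<^esub> k = l"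
      using c by (auto simp: h_def H.m_assoc)
    have hu: "h' = h" if "h' \<in> carrier H" "h' \<otimes>\<^bsub>H\<^esub> k = l" for h'
      using that c h H.right_cancel by metis
    obtain p where p: "p \<in> carrier N" "p \<otimes>\<^bsub>N\<^esub> \<phi> h n = m"
      and pu: "\<And>q. q \<in> carrier N \<Longrightarrow> q \<otimes>\<^bsub>N\<^esub> \<phi> h n = m \<Longrightarrow> q = p"
      using N.ex1_left[OF cl[OF h(1) c(1)] c(3)] by blast
    show ?case
    proof (rule ex1I[of _ "(p, h)"], goal_cases)
      case 1 then show ?case using ab p h by (simp add: semidirect_def)
    next
      case (2 z)
      then obtain u v where z: "z = (u, v)" and uv: "u \<in> carrier N" "v \<in> carrier H"
          "u \<otimes>\<^bsub>N\<^esub> \<phi> v n = m" "v \<otimes>\<^bsub>H\<^esub> k = l"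
        using ab by (cases z) (auto simp: semidirect_def)
      have "v = h" using hu[OF uv(2,4)] .
      moreover from this have "u = p" using pu uv by blast
      ultimately show ?case using z by simp
    qed
  next
    case (6 a b)
    obtain n k m l where ab: "a = (n, k)" "b = (m, l)" by (cases a, cases b)
    with 6 have c: "n \<in> carrier N" "k \<in> carrier H" "m \<in> carrier N" "l \<in> carrier H"
      by (auto simp: semidirect_def)
    define h where "h = inv\<^bsub>H\<^esub> k \<otimes>\<^bsub>H\<^esub> l"
    have h: "h \<in> carrier H" "k \<otimes>\<^bsub>H\<^esub> h = l"
      using c by (auto simp: h_def H.m_assoc[symmetric])
    have hu: "h' = h" if "h' \<in> carrier H" "k \<otimes>\<^bsub>H\<^esub> h' = l" for h'
      using that c h H.Units_l_cancel by (metis H.Units_eq)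
    obtain p where p: "p \<in> carrier N" "n \<otimes>\<^bsub>N\<^esub> p = m"
      and pu: "\<And>q. q \<in> carrier N \<Longrightarrow> n \<otimes>\<^bsub>N\<^esub> q = m \<Longrightarrow> q = p"
      using N.ex1_right[OF c(1) c(3)] by blast
    have "p \<in> \<phi> k ` carrier N"
      using p(1) unfolding bij_betw_imp_surj_on[OF bij[OF c(2)]] .
    then obtain r where r: "p = \<phi> k r" "r \<in> carrier N"
      by (rule imageE)
    have ru: "r' = r" if "r' \<in> carrier N" "n \<otimes>\<^bsub>N\<^esub> \<phi> k r' = m" for r'
    proof (rule inj_onD[OF bij_betw_imp_inj_on[OF bij[OF c(2)]] _ that(1) r(2)])
      show "\<phi> k r' = \<phi> k r"
        using pu[OF cl[OF c(2) that(1)] that(2)] unfolding r(1) .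
    qed
    show ?case
    proof (rule ex1I[of _ "(r, h)"], goal_cases)
      case 1 then show ?case using ab p h r by (simp add: semidirect_def)
    next
      case (2 z)
      then obtain u v where z: "z = (u, v)" and uv: "u \<in> carrier N" "v \<in> carrier H"
          "n \<otimes>\<^bsub>N\<^esub> \<phi> k u = m" "k \<otimes>\<^bsub>H\<^esub> v = l"
        using ab by (cases z) (auto simp: semidirect_def)
      have "v = h" using hu[OF uv(2,4)] .
      moreover from this have "u = r" using ru uv by blast
      ultimately show ?case using z by simp
    qed
  qed
qed

end

theory Submission
  imports Defs
begin

text \<open>
  In the semidirect product, \<open>(x, y)\<close> commutes with \<open>(n, h)\<close> iff \<open>y\<close> commutes with \<open>h\<close> and
  \<open>x \<phi>\<^sub>y(n) = n \<phi>\<^sub>h(x)\<close>. The second equation, for all \<open>n\<close> and \<open>h\<close> together, separates into a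
  condition on \<open>x\<close> alone and one linking \<open>x\<close> with \<open>y\<close>: putting \<open>n = 1\<close> and using
  \<open>\<phi>\<^sub>y(1) = 1\<close> gives \<open>x = \<phi>\<^sub>h(x)\<close>, after which the equation becomes \<open>x \<phi>\<^sub>y(n) = n x\<close>
  (lemma \<open>twisted_commuting_iff\<close>). The left inverse property solves this for \<open>\<phi>\<^sub>y(n)\<close>,
  namely \<open>\<phi>\<^sub>y(n) = x\<inverse>(n x)\<close>, which says that \<open>\<phi>\<^sub>y\<close> is \<open>i\<close> at \<open>x\<inverse>\<close>
  (lemma \<open>eq_imap_inv_iff\<close>).
\<close>

lemma (in lip_loop) left_mult_eq_iff:
  assumes "x \<in> carrier N" "a \<in> carrier N" "b \<in> carrier N"
  shows "x \<otimes> a = b \<longleftrightarrow> a = inv x \<otimes> b"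
proof
  assume "x \<otimes> a = b"
  then show "a = inv x \<otimes> b"
    using inv_left[OF assms(1,2)] by simp
next
  assume "a = inv x \<otimes> b"
  \<comment> \<open>The left inverse property for \<open>x\<inverse>\<close> reads \<open>x (x\<inverse> b) = b\<close>, since \<open>x\<inverse>\<close> has inverse \<open>x\<close>.\<close>
  then show "x \<otimes> a = b"
    using inv_left[OF inv_closed[OF assms(1)] assms(3)] inv_inv[OF assms(1)] by simp
qed

text \<open>
  The defining equation of \<open>i\<close> at \<open>x\<inverse>\<close> can be cleared of inverses by multiplying with \<open>x\<close> on
  the left. Extensionality of \<open>f\<close> turns the pointwise equations into equality of functions.
\<close>

lemma (in lip_loop) eq_imap_inv_iff:
  assumes x: "x \<in> carrier N"
    and ext: "f \<in> extensional (carrier N)" and cl: "f \<in> carrier N \<rightarrow> carrier N"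
  shows "f = imap N (inv x) \<longleftrightarrow> (\<forall>n \<in> carrier N. x \<otimes> f n = n \<otimes> x)"
proof -
  have "imap N (inv x) \<in> extensional (carrier N)"
    by (simp add: imap_def)
  then have "f = imap N (inv x) \<longleftrightarrow> (\<forall>n \<in> carrier N. f n = imap N (inv x) n)"
    using ext by (auto intro: extensionalityI)
  also have "\<dots> \<longleftrightarrow> (\<forall>n \<in> carrier N. x \<otimes> f n = n \<otimes> x)"
    using x cl by (auto simp: imap_inv left_mult_eq_iff m_closed Pi_iff)
  finally show ?thesis .
qed

text \<open>
  At \<open>n = 1\<close> the left side is \<open>x\<close>, because \<open>f\<close> fixes \<open>1\<close>; this forces every \<open>\<phi>\<^sub>h\<close> to fix \<open>x\<close>,
  and then \<open>h\<close> disappears from the equation. Below, \<open>f\<close> is \<open>\<phi>\<^sub>y\<close> and \<open>I\<close> is the carrier of \<open>H\<close>.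
\<close>

lemma (in loop) twisted_commuting_iff:
  assumes x: "x \<in> carrier N" and "I \<noteq> {}" and f1: "f \<one> = \<one>"
    and cl: "\<And>h. h \<in> I \<Longrightarrow> \<phi> h x \<in> carrier N"
  shows "(\<forall>n \<in> carrier N. \<forall>h \<in> I. x \<otimes> f n = n \<otimes> \<phi> h x) \<longleftrightarrow>
    (\<forall>h \<in> I. \<phi> h x = x) \<and> (\<forall>n \<in> carrier N. x \<otimes> f n = n \<otimes> x)"
    (is "?L \<longleftrightarrow> ?R")
proof
  assume L: ?L
  have x_fixed: "\<phi> h x = x" if "h \<in> I" for h
  proof -
    have "x \<otimes> f \<one> = \<one> \<otimes> \<phi> h x"
      using L one_closed that by blast
    then show ?thesis
      using f1 x cl[OF that] by (simp add: l_one r_one)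
  qed
  with L x_fixed \<open>I \<noteq> {}\<close> show ?R
    by fastforce
qed simp

theorem theorem3p4:
  fixes N :: "('a, 'c) monoid_scheme" and H :: "('h, 'd) monoid_scheme"
    and \<phi> :: "'h \<Rightarrow> 'a \<Rightarrow> 'a"
  assumes "lip_loop N" and "group H" and "\<phi> \<in> hom H (Sym1 N)"
  shows "commutant (semidirect N \<phi> H) =
    {(x, y) \<in> carrier N \<times> carrier H.
      x \<in> Fix N H \<phi> \<and> y \<in> group_center H \<and> \<phi> y = imap N (inv\<^bsub>N\<^esub> x)}"
proof -
  interpret N: lip_loop N by fact
  interpret H: group H by fact
  note \<phi> = hom_Sym1_D[OF assms(3)]
  have cl: "\<phi> h \<in> carrier N \<rightarrow> carrier N" if "h \<in> carrier H" for h
    using \<phi>(2)[OF that] by (rule bij_betw_imp_funcset)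
  have key: "(x, y) \<in> commutant (semidirect N \<phi> H) \<longleftrightarrow>
      x \<in> Fix N H \<phi> \<and> y \<in> group_center H \<and> \<phi> y = imap N (inv\<^bsub>N\<^esub> x)"
    if x: "x \<in> carrier N" and y: "y \<in> carrier H" for x y
  proof -
    have "(x, y) \<in> commutant (semidirect N \<phi> H) \<longleftrightarrow>
        (\<forall>n \<in> carrier N. \<forall>h \<in> carrier H. x \<otimes>\<^bsub>N\<^esub> \<phi> y n = n \<otimes>\<^bsub>N\<^esub> \<phi> h x)
        \<and> y \<in> group_center H"
      using x y N.one_closed by (auto simp: commutant_def semidirect_def group_center_def)
    also have "\<dots> \<longleftrightarrow> ((\<forall>h \<in> carrier H. \<phi> h x = x)
        \<and> (\<forall>n \<in> carrier N. x \<otimes>\<^bsub>N\<^esub> \<phi> y n = n \<otimes>\<^bsub>N\<^esub> x)) \<and> y \<in> group_center H"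
      using N.twisted_commuting_iff[of x "carrier H" "\<phi> y" \<phi>] \<phi>(3)[OF y] cl x y by blast
    also have "\<dots> \<longleftrightarrow> x \<in> Fix N H \<phi> \<and> y \<in> group_center H \<and> \<phi> y = imap N (inv\<^bsub>N\<^esub> x)"
      using N.eq_imap_inv_iff[OF x \<phi>(1)[OF y] cl[OF y]] x by (auto simp: Fix_def)
    finally show ?thesis .
  qed
  have "commutant (semidirect N \<phi> H) \<subseteq> carrier N \<times> carrier H"
    by (auto simp: commutant_def semidirect_def)
  with key show ?thesis
    by auto
qed

end
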